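(* Let $R$ be a commutative ring with unity. The following conditions are equivalent: (1) For each $R$-algebra $S$ and for each indecomposable left $S$-module $M$, $\mathrm{Supp}\,M$ contains only one maximal ideal. (2) $R$ is clean. When these conditions are satisfied, for each $R$-algebra $S$ and each indecomposable left $S$-module $M$, one has $M=M_P$ (i.e. the canonical map $M\to M_P$ is an isomorphism), where $P$ is the unique maximal ideal of $R$ in $\mathrm{Supp}\,M$.
   Context: $R$ is clean if each element of $R$ is the sum of a unit and an idempotent. $R$-algebras are associative and unital but not necessarily commutative. For a left $S$-module $M$, viewed as an $R$-module, $\mathrm{Supp}\,M=\{P\in\mathrm{Spec}\,R\mid M_P\neq 0\}$. Indecomposable modules are nonzero. *)

theory Defs
  imports "HOL-Algebra.Module" "HOL-Algebra.Ideal"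
begin

section \<open>Clean rings\<close>

definition clean_ring :: "('a, 'r) ring_scheme \<Rightarrow> bool" where
  "clean_ring R \<longleftrightarrow>
     (\<forall>x \<in> carrier R. \<exists>u \<in> Units R. \<exists>e \<in> carrier R.
        e \<otimes>\<^bsub>R\<^esub> e = e \<and> x = u \<oplus>\<^bsub>R\<^esub> e)"


section \<open>Algebras over a commutative ring, and left modules over them\<close>

text \<open>The library locale \<open>algebra\<close> forces the algebra to be commutative. Without commutativity
  the scalars must be required to move past both factors of a product, i.e. the image of \<open>R\<close> is
  central.\<close>

locale assoc_algebra = module R S + S?: ring S
  for R :: "('a, 'r) ring_scheme" (structure) and S :: "('a, 's, 'x) module_scheme" (structure) +
  assumes smult_mult_left:
      "\<lbrakk>a \<in> carrier R; x \<in> carrier S; y \<in> carrier S\<rbrakk> \<Longrightarrow>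
        (a \<odot>\<^bsub>S\<^esub> x) \<otimes>\<^bsub>S\<^esub> y = a \<odot>\<^bsub>S\<^esub> (x \<otimes>\<^bsub>S\<^esub> y)"
    and smult_mult_right:
      "\<lbrakk>a \<in> carrier R; x \<in> carrier S; y \<in> carrier S\<rbrakk> \<Longrightarrow>
        x \<otimes>\<^bsub>S\<^esub> (a \<odot>\<^bsub>S\<^esub> y) = a \<odot>\<^bsub>S\<^esub> (x \<otimes>\<^bsub>S\<^esub> y)"

text \<open>The axioms are those of the library locale \<open>module\<close>, which is restricted to commutative
  rings of scalars. The library notion \<open>submodule\<close> has no such restriction.\<close>

locale left_module = S?: ring S + M?: abelian_group M
  for S :: "('s, 'r) ring_scheme" (structure) and M :: "('s, 'm, 'x) module_scheme" (structure) +
  assumes left_smult_closed: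
      "\<lbrakk>a \<in> carrier S; x \<in> carrier M\<rbrakk> \<Longrightarrow> a \<odot>\<^bsub>M\<^esub> x \<in> carrier M"
    and left_smult_l_distr:
      "\<lbrakk>a \<in> carrier S; b \<in> carrier S; x \<in> carrier M\<rbrakk> \<Longrightarrow>
        (a \<oplus>\<^bsub>S\<^esub> b) \<odot>\<^bsub>M\<^esub> x = a \<odot>\<^bsub>M\<^esub> x \<oplus>\<^bsub>M\<^esub> b \<odot>\<^bsub>M\<^esub> x"
    and left_smult_r_distr:
      "\<lbrakk>a \<in> carrier S; x \<in> carrier M; y \<in> carrier M\<rbrakk> \<Longrightarrow>
        a \<odot>\<^bsub>M\<^esub> (x \<oplus>\<^bsub>M\<^esub> y) = a \<odot>\<^bsub>M\<^esub> x \<oplus>\<^bsub>M\<^esub> a \<odot>\<^bsub>M\<^esub> y"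
    and left_smult_assoc:
      "\<lbrakk>a \<in> carrier S; b \<in> carrier S; x \<in> carrier M\<rbrakk> \<Longrightarrow>
        (a \<otimes>\<^bsub>S\<^esub> b) \<odot>\<^bsub>M\<^esub> x = a \<odot>\<^bsub>M\<^esub> (b \<odot>\<^bsub>M\<^esub> x)"
    and left_smult_one:
      "x \<in> carrier M \<Longrightarrow> \<one>\<^bsub>S\<^esub> \<odot>\<^bsub>M\<^esub> x = x"

definition indecomposable_module ::
    "('s, 'r) ring_scheme \<Rightarrow> ('s, 'm, 'x) module_scheme \<Rightarrow> bool" where
  "indecomposable_module S M \<longleftrightarrow>
     left_module S M \<and> carrier M \<noteq> {\<zero>\<^bsub>M\<^esub>} \<and>
     (\<forall>A B. submodule A S M \<and> submodule B S M \<and>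
        A \<inter> B = {\<zero>\<^bsub>M\<^esub>} \<and> A <+>\<^bsub>M\<^esub> B = carrier M \<longrightarrow>
        A = {\<zero>\<^bsub>M\<^esub>} \<or> B = {\<zero>\<^bsub>M\<^esub>})"

text \<open>A left module over an \<open>R\<close>-algebra \<open>S\<close>, viewed as an \<open>R\<close>-module through the structure map
  \<open>r \<mapsto> r \<cdot> 1\<close> of \<open>S\<close>.\<close>

definition restrict_scalars ::
    "('a, 's, 'x) module_scheme \<Rightarrow> ('s, 'm) module \<Rightarrow> ('a, 'm) module" where
  "restrict_scalars S M =
     \<lparr>carrier = carrier M, mult = mult M, one = one M, zero = zero M, add = add M,
      smult = (\<lambda>r x. (r \<odot>\<^bsub>S\<^esub> \<one>\<^bsub>S\<^esub>) \<odot>\<^bsub>M\<^esub> x)\<rparr>"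


section \<open>Localization of a module at a prime ideal, and the support\<close>

definition frac_rel ::
    "('a, 'r) ring_scheme \<Rightarrow> ('a, 'm, 'x) module_scheme \<Rightarrow> 'a set \<Rightarrow> (('m \<times> 'a) \<times> ('m \<times> 'a)) set" where
  "frac_rel R M P =
     {((x, s), (y, t)).
        x \<in> carrier M \<and> s \<in> carrier R - P \<and> y \<in> carrier M \<and> t \<in> carrier R - P \<and>
        (\<exists>w \<in> carrier R - P. w \<odot>\<^bsub>M\<^esub> (t \<odot>\<^bsub>M\<^esub> x) = w \<odot>\<^bsub>M\<^esub> (s \<odot>\<^bsub>M\<^esub> y))}"

definition frac ::
    "('a, 'r) ring_scheme \<Rightarrow> ('a, 'm, 'x) module_scheme \<Rightarrow> 'a set \<Rightarrow> 'm \<Rightarrow> 'a \<Rightarrow> ('m \<times> 'a) set" where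
  "frac R M P x s = frac_rel R M P `` {(x, s)}"

text \<open>\<open>M\<^sub>P\<close> as an \<open>R\<close>-module. The fields \<open>mult\<close> and \<open>one\<close>, which the record type inherits from
  rings, are irrelevant for a module. The operations take the union over all representatives, which
  all yield the same class (\<open>add_frac\<close> and \<open>smult_frac\<close> below).\<close>

definition localization ::
    "('a, 'r) ring_scheme \<Rightarrow> ('a, 'm, 'x) module_scheme \<Rightarrow> 'a set \<Rightarrow> ('a, ('m \<times> 'a) set) module" where
  "localization R M P =
     \<lparr>carrier = (carrier M \<times> (carrier R - P)) // frac_rel R M P,
      mult = undefined, one = undefined,
      zero = frac R M P \<zero>\<^bsub>M\<^esub> \<one>\<^bsub>R\<^esub>,
      add = (\<lambda>X Y.
        \<Union>{frac R M P (t \<odot>\<^bsub>M\<^esub> x \<oplus>\<^bsub>M\<^esub> s \<odot>\<^bsub>M\<^esub> y) (s \<otimes>\<^bsub>R\<^esub> t) | x s y t.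
          (x, s) \<in> X \<and> (y, t) \<in> Y}),
      smult = (\<lambda>a X. \<Union>{frac R M P (a \<odot>\<^bsub>M\<^esub> x) s | x s. (x, s) \<in> X})\<rparr>"

definition Supp :: "('a, 'r) ring_scheme \<Rightarrow> ('a, 'm, 'x) module_scheme \<Rightarrow> 'a set set" where
  "Supp R M =
     {P. primeideal P R \<and>
         carrier (localization R M P) \<noteq> {\<zero>\<^bsub>localization R M P\<^esub>}}"

definition module_iso ::
    "('a, 'r) ring_scheme \<Rightarrow> ('a, 'm, 'x) module_scheme \<Rightarrow> ('a, 'n, 'y) module_scheme \<Rightarrow>
     ('m \<Rightarrow> 'n) set" where
  "module_iso R M N =
     {f \<in> iso (add_monoid M) (add_monoid N).
        \<forall>a \<in> carrier R. \<forall>x \<in> carrier M. f (a \<odot>\<^bsub>M\<^esub> x) = a \<odot>\<^bsub>N\<^esub> f x}"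

definition localization_map ::
    "('a, 'r) ring_scheme \<Rightarrow> ('a, 'm, 'x) module_scheme \<Rightarrow> 'a set \<Rightarrow> 'm \<Rightarrow> ('m \<times> 'a) set" where
  "localization_map R M P = (\<lambda>x. frac R M P x \<one>\<^bsub>R\<^esub>)"


section \<open>Well-definedness\<close>

locale module_at_prime = module R M + primeideal P R
  for R :: "('a, 'r) ring_scheme" (structure) and M :: "('a, 'm, 'x) module_scheme" (structure)
    and P
begin

lemma one_not_in_P: "\<one> \<in> carrier R - P"
  using I_notcarr one_imp_carrier by auto

lemma mult_not_in_P: "\<lbrakk>s \<in> carrier R - P; t \<in> carrier R - P\<rbrakk> \<Longrightarrow> s \<otimes> t \<in> carrier R - P"
  using I_prime by auto

lemma equiv_frac_rel: "equiv (carrier M \<times> (carrier R - P)) (frac_rel R M P)"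
proof (rule equivI)
  show "frac_rel R M P \<subseteq> (carrier M \<times> (carrier R - P)) \<times> (carrier M \<times> (carrier R - P))"
    by (auto simp: frac_rel_def)
  show "refl_on (carrier M \<times> (carrier R - P)) (frac_rel R M P)"
    using one_not_in_P by (auto simp: frac_rel_def refl_on_def)
  show "sym (frac_rel R M P)"
    unfolding sym_def frac_rel_def by (auto intro: sym)
  show "trans (frac_rel R M P)"
  proof (rule transI, clarsimp simp: frac_rel_def)
    fix x s y t z u v w
    assume c: "x \<in> carrier M" "s \<in> carrier R" "y \<in> carrier M" "t \<in> carrier R"
        "z \<in> carrier M" "u \<in> carrier R" "v \<in> carrier R" "w \<in> carrier R"
      and n: "s \<notin> P" "t \<notin> P" "u \<notin> P" "v \<notin> P" "w \<notin> P"
      and e1: "v \<odot>\<^bsub>M\<^esub> (t \<odot>\<^bsub>M\<^esub> x) = v \<odot>\<^bsub>M\<^esub> (s \<odot>\<^bsub>M\<^esub> y)"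
      and e2: "w \<odot>\<^bsub>M\<^esub> (u \<odot>\<^bsub>M\<^esub> y) = w \<odot>\<^bsub>M\<^esub> (t \<odot>\<^bsub>M\<^esub> z)"
    let ?k = "v \<otimes> w \<otimes> t"
    have k: "?k \<in> carrier R - P"
      using c n by (intro mult_not_in_P) auto
    have "?k \<odot>\<^bsub>M\<^esub> (u \<odot>\<^bsub>M\<^esub> x) = (w \<otimes> u) \<odot>\<^bsub>M\<^esub> (v \<odot>\<^bsub>M\<^esub> (t \<odot>\<^bsub>M\<^esub> x))"
      using c by (simp add: smult_assoc1[symmetric] R.m_ac)
    also have "\<dots> = (v \<otimes> s) \<odot>\<^bsub>M\<^esub> (w \<odot>\<^bsub>M\<^esub> (u \<odot>\<^bsub>M\<^esub> y))"
      unfolding e1 using c by (simp add: smult_assoc1[symmetric] R.m_ac)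
    also have "\<dots> = ?k \<odot>\<^bsub>M\<^esub> (s \<odot>\<^bsub>M\<^esub> z)"
      unfolding e2 using c by (simp add: smult_assoc1[symmetric] R.m_ac)
    finally show "\<exists>w\<in>carrier R - P. w \<odot>\<^bsub>M\<^esub> (u \<odot>\<^bsub>M\<^esub> x) = w \<odot>\<^bsub>M\<^esub> (s \<odot>\<^bsub>M\<^esub> z)"
      using k by blast
  qed
qed

lemma frac_eq_iff:
  assumes "x \<in> carrier M" "s \<in> carrier R - P" "y \<in> carrier M" "t \<in> carrier R - P"
  shows "frac R M P x s = frac R M P y t \<longleftrightarrow>
    (\<exists>w \<in> carrier R - P. w \<odot>\<^bsub>M\<^esub> (t \<odot>\<^bsub>M\<^esub> x) = w \<odot>\<^bsub>M\<^esub> (s \<odot>\<^bsub>M\<^esub> y))"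
  unfolding frac_def using eq_equiv_class_iff[OF equiv_frac_rel, of "(x, s)" "(y, t)"] assms
  by (auto simp: frac_rel_def)

lemma mem_frac:
  assumes "x \<in> carrier M" "s \<in> carrier R - P"
  shows "(y, t) \<in> frac R M P x s \<longleftrightarrow>
    y \<in> carrier M \<and> t \<in> carrier R - P \<and> frac R M P y t = frac R M P x s"
  using assms frac_eq_iff[of x s y t]
  by (auto simp: frac_def[of R M P x s] frac_rel_def)

lemma carrier_localization:
  "carrier (localization R M P) = {frac R M P x s | x s. x \<in> carrier M \<and> s \<in> carrier R - P}"
  by (auto simp: localization_def quotient_def frac_def)

lemma frac_closed:
  "\<lbrakk>x \<in> carrier M; s \<in> carrier R - P\<rbrakk> \<Longrightarrow> frac R M P x s \<in> carrier (localization R M P)"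
  by (auto simp: carrier_localization)

lemma add_frac:
  assumes "x \<in> carrier M" "s \<in> carrier R - P" "y \<in> carrier M" "t \<in> carrier R - P"
  shows "frac R M P x s \<oplus>\<^bsub>localization R M P\<^esub> frac R M P y t =
    frac R M P (t \<odot>\<^bsub>M\<^esub> x \<oplus>\<^bsub>M\<^esub> s \<odot>\<^bsub>M\<^esub> y) (s \<otimes> t)"
proof -
  have *: "frac R M P (t' \<odot>\<^bsub>M\<^esub> x' \<oplus>\<^bsub>M\<^esub> s' \<odot>\<^bsub>M\<^esub> y') (s' \<otimes> t') =
      frac R M P (t \<odot>\<^bsub>M\<^esub> x \<oplus>\<^bsub>M\<^esub> s \<odot>\<^bsub>M\<^esub> y) (s \<otimes> t)"
    if "(x', s') \<in> frac R M P x s" "(y', t') \<in> frac R M P y t" for x' s' y' t'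
  proof -
    from that assms have c: "x' \<in> carrier M" "s' \<in> carrier R - P" "y' \<in> carrier M" "t' \<in> carrier R - P"
      and e: "frac R M P x' s' = frac R M P x s" "frac R M P y' t' = frac R M P y t"
      by (auto simp: mem_frac)
    obtain v where v: "v \<in> carrier R - P" "v \<odot>\<^bsub>M\<^esub> (s \<odot>\<^bsub>M\<^esub> x') = v \<odot>\<^bsub>M\<^esub> (s' \<odot>\<^bsub>M\<^esub> x)"
      using e(1) c assms by (auto simp: frac_eq_iff)
    obtain w where w: "w \<in> carrier R - P" "w \<odot>\<^bsub>M\<^esub> (t \<odot>\<^bsub>M\<^esub> y') = w \<odot>\<^bsub>M\<^esub> (t' \<odot>\<^bsub>M\<^esub> y)"
      using e(2) c assms by (auto simp: frac_eq_iff)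
    have cc: "s \<in> carrier R" "t \<in> carrier R" "s' \<in> carrier R" "t' \<in> carrier R" "v \<in> carrier R"
      "w \<in> carrier R"
      using c v w assms by auto
    have 1: "(v \<otimes> w) \<odot>\<^bsub>M\<^esub> ((s \<otimes> t) \<odot>\<^bsub>M\<^esub> (t' \<odot>\<^bsub>M\<^esub> x')) =
        (v \<otimes> w) \<odot>\<^bsub>M\<^esub> ((s' \<otimes> t') \<odot>\<^bsub>M\<^esub> (t \<odot>\<^bsub>M\<^esub> x))"
    proof -
      have "(v \<otimes> w) \<odot>\<^bsub>M\<^esub> ((s \<otimes> t) \<odot>\<^bsub>M\<^esub> (t' \<odot>\<^bsub>M\<^esub> x')) =
          (w \<otimes> t \<otimes> t') \<odot>\<^bsub>M\<^esub> (v \<odot>\<^bsub>M\<^esub> (s \<odot>\<^bsub>M\<^esub> x'))"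
        using c(1) cc by (simp add: smult_assoc1[symmetric] R.m_ac)
      also have "\<dots> = (v \<otimes> w) \<odot>\<^bsub>M\<^esub> ((s' \<otimes> t') \<odot>\<^bsub>M\<^esub> (t \<odot>\<^bsub>M\<^esub> x))"
        unfolding v(2) using assms(1) cc by (simp add: smult_assoc1[symmetric] R.m_ac)
      finally show ?thesis .
    qed
    have 2: "(v \<otimes> w) \<odot>\<^bsub>M\<^esub> ((s \<otimes> t) \<odot>\<^bsub>M\<^esub> (s' \<odot>\<^bsub>M\<^esub> y')) =
        (v \<otimes> w) \<odot>\<^bsub>M\<^esub> ((s' \<otimes> t') \<odot>\<^bsub>M\<^esub> (s \<odot>\<^bsub>M\<^esub> y))"
    proof -
      have "(v \<otimes> w) \<odot>\<^bsub>M\<^esub> ((s \<otimes> t) \<odot>\<^bsub>M\<^esub> (s' \<odot>\<^bsub>M\<^esub> y')) =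
          (v \<otimes> s \<otimes> s') \<odot>\<^bsub>M\<^esub> (w \<odot>\<^bsub>M\<^esub> (t \<odot>\<^bsub>M\<^esub> y'))"
        using c(3) cc by (simp add: smult_assoc1[symmetric] R.m_ac)
      also have "\<dots> = (v \<otimes> w) \<odot>\<^bsub>M\<^esub> ((s' \<otimes> t') \<odot>\<^bsub>M\<^esub> (s \<odot>\<^bsub>M\<^esub> y))"
        unfolding w(2) using assms(3) cc by (simp add: smult_assoc1[symmetric] R.m_ac)
      finally show ?thesis .
    qed
    have "(v \<otimes> w) \<odot>\<^bsub>M\<^esub> ((s \<otimes> t) \<odot>\<^bsub>M\<^esub> (t' \<odot>\<^bsub>M\<^esub> x' \<oplus>\<^bsub>M\<^esub> s' \<odot>\<^bsub>M\<^esub> y')) =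
        (v \<otimes> w) \<odot>\<^bsub>M\<^esub> ((s' \<otimes> t') \<odot>\<^bsub>M\<^esub> (t \<odot>\<^bsub>M\<^esub> x \<oplus>\<^bsub>M\<^esub> s \<odot>\<^bsub>M\<^esub> y))"
      using 1 2 c cc assms by (simp add: smult_r_distr)
    moreover have "v \<otimes> w \<in> carrier R - P" "s \<otimes> t \<in> carrier R - P" "s' \<otimes> t' \<in> carrier R - P"
      using mult_not_in_P v(1) w(1) c(2,4) assms(2,4) by blast+
    moreover have "t' \<odot>\<^bsub>M\<^esub> x' \<oplus>\<^bsub>M\<^esub> s' \<odot>\<^bsub>M\<^esub> y' \<in> carrier M" "t \<odot>\<^bsub>M\<^esub> x \<oplus>\<^bsub>M\<^esub> s \<odot>\<^bsub>M\<^esub> y \<in> carrier M"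
      using c cc assms by auto
    ultimately show ?thesis
      by (subst frac_eq_iff) auto
  qed
  have "(x, s) \<in> frac R M P x s" "(y, t) \<in> frac R M P y t"
    using assms by (auto simp: mem_frac)
  with * have "{frac R M P (t' \<odot>\<^bsub>M\<^esub> x' \<oplus>\<^bsub>M\<^esub> s' \<odot>\<^bsub>M\<^esub> y') (s' \<otimes> t') | x' s' y' t'.
      (x', s') \<in> frac R M P x s \<and> (y', t') \<in> frac R M P y t} =
      {frac R M P (t \<odot>\<^bsub>M\<^esub> x \<oplus>\<^bsub>M\<^esub> s \<odot>\<^bsub>M\<^esub> y) (s \<otimes> t)}"
    by blast
  then show ?thesis
    by (simp add: localization_def)
qed

lemma smult_frac:
  assumes "a \<in> carrier R" "x \<in> carrier M" "s \<in> carrier R - P"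
  shows "a \<odot>\<^bsub>localization R M P\<^esub> frac R M P x s = frac R M P (a \<odot>\<^bsub>M\<^esub> x) s"
proof -
  have *: "frac R M P (a \<odot>\<^bsub>M\<^esub> x') s' = frac R M P (a \<odot>\<^bsub>M\<^esub> x) s"
    if "(x', s') \<in> frac R M P x s" for x' s'
  proof -
    from that assms have c: "x' \<in> carrier M" "s' \<in> carrier R - P"
      and e: "frac R M P x' s' = frac R M P x s"
      by (auto simp: mem_frac)
    obtain v where v: "v \<in> carrier R - P" "v \<odot>\<^bsub>M\<^esub> (s \<odot>\<^bsub>M\<^esub> x') = v \<odot>\<^bsub>M\<^esub> (s' \<odot>\<^bsub>M\<^esub> x)"
      using e c assms by (auto simp: frac_eq_iff)
    have "v \<odot>\<^bsub>M\<^esub> (s \<odot>\<^bsub>M\<^esub> (a \<odot>\<^bsub>M\<^esub> x')) = a \<odot>\<^bsub>M\<^esub> (v \<odot>\<^bsub>M\<^esub> (s \<odot>\<^bsub>M\<^esub> x'))"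
      using c v(1) assms by (simp add: smult_assoc1[symmetric] R.m_ac)
    also have "\<dots> = v \<odot>\<^bsub>M\<^esub> (s' \<odot>\<^bsub>M\<^esub> (a \<odot>\<^bsub>M\<^esub> x))"
      unfolding v(2) using c v(1) assms by (simp add: smult_assoc1[symmetric] R.m_ac)
    finally show ?thesis
      using c v(1) assms by (subst frac_eq_iff) auto
  qed
  have "(x, s) \<in> frac R M P x s"
    using assms by (auto simp: mem_frac)
  with * have "{frac R M P (a \<odot>\<^bsub>M\<^esub> x') s' | x' s'. (x', s') \<in> frac R M P x s} =
      {frac R M P (a \<odot>\<^bsub>M\<^esub> x) s}"
    by blast
  then show ?thesis
    by (simp add: localization_def)
qed

lemma zero_localization: "\<zero>\<^bsub>localization R M P\<^esub> = frac R M P \<zero>\<^bsub>M\<^esub> \<one>"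
  by (simp add: localization_def)

lemma frac_eqI:
  assumes "x \<in> carrier M" "s \<in> carrier R - P" "y \<in> carrier M" "t \<in> carrier R - P"
    and "t \<odot>\<^bsub>M\<^esub> x = s \<odot>\<^bsub>M\<^esub> y"
  shows "frac R M P x s = frac R M P y t"
  using assms one_not_in_P by (auto simp: frac_eq_iff)

lemma module_localization: "module R (localization R M P)"
proof -
  let ?L = "localization R M P"
  have E: "\<exists>x s. X = frac R M P x s \<and> x \<in> carrier M \<and> s \<in> carrier R \<and> s \<notin> P"
    if "X \<in> carrier ?L" for X
    using that by (auto simp: carrier_localization)
  have m: "s \<otimes> t \<in> carrier R - P" if "s \<in> carrier R" "s \<notin> P" "t \<in> carrier R" "t \<notin> P" for s t
    using that mult_not_in_P by blast
  have m': "s \<otimes> t \<notin> P" if "s \<in> carrier R" "s \<notin> P" "t \<in> carrier R" "t \<notin> P" for s t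
    using m[OF that] by blast
  note o = one_not_in_P
  note ac = smult_assoc1[symmetric] smult_r_distr R.m_ac M.a_ac
  show ?thesis
  proof (rule moduleI)
    show "cring R" by (rule R.cring_axioms)
    show "abelian_group ?L"
    proof (rule abelian_groupI)
      fix X Y assume "X \<in> carrier ?L" "Y \<in> carrier ?L"
      then obtain x s y t where "X = frac R M P x s" "x \<in> carrier M" "s \<in> carrier R" "s \<notin> P"
          "Y = frac R M P y t" "y \<in> carrier M" "t \<in> carrier R" "t \<notin> P"
        using E by metis
      then show "X \<oplus>\<^bsub>?L\<^esub> Y \<in> carrier ?L" "X \<oplus>\<^bsub>?L\<^esub> Y = Y \<oplus>\<^bsub>?L\<^esub> X"
        using m' by (auto simp: add_frac R.m_comm M.a_comm intro!: frac_closed)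
    next
      show "\<zero>\<^bsub>?L\<^esub> \<in> carrier ?L"
        using o by (auto simp: zero_localization intro!: frac_closed)
    next
      fix X Y Z assume "X \<in> carrier ?L" "Y \<in> carrier ?L" "Z \<in> carrier ?L"
      then obtain x s y t z u where "X = frac R M P x s" "x \<in> carrier M" "s \<in> carrier R" "s \<notin> P"
          "Y = frac R M P y t" "y \<in> carrier M" "t \<in> carrier R" "t \<notin> P"
          "Z = frac R M P z u" "z \<in> carrier M" "u \<in> carrier R" "u \<notin> P"
        using E by metis
      then show "X \<oplus>\<^bsub>?L\<^esub> Y \<oplus>\<^bsub>?L\<^esub> Z = X \<oplus>\<^bsub>?L\<^esub> (Y \<oplus>\<^bsub>?L\<^esub> Z)"
        using m' by (simp add: add_frac ac)
    next
      fix X assume "X \<in> carrier ?L"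
      then obtain x s where X: "X = frac R M P x s" "x \<in> carrier M" "s \<in> carrier R" "s \<notin> P"
        using E by metis
      then show "\<zero>\<^bsub>?L\<^esub> \<oplus>\<^bsub>?L\<^esub> X = X"
        using o by (simp add: zero_localization add_frac)
      have "frac R M P (\<ominus>\<^bsub>M\<^esub> x) s \<oplus>\<^bsub>?L\<^esub> X = \<zero>\<^bsub>?L\<^esub>"
        using X o m'
        by (simp add: zero_localization add_frac smult_r_distr[symmetric] M.l_neg, intro frac_eqI)
          simp_all
      then show "\<exists>Y \<in> carrier ?L. Y \<oplus>\<^bsub>?L\<^esub> X = \<zero>\<^bsub>?L\<^esub>"
        using X by (auto intro!: bexI frac_closed)
    qed
  next
    fix a X assume "a \<in> carrier R" "X \<in> carrier ?L"
    moreover from this obtain x s where "X = frac R M P x s" "x \<in> carrier M" "s \<in> carrier R" "s \<notin> P"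
      using E by metis
    ultimately show "a \<odot>\<^bsub>?L\<^esub> X \<in> carrier ?L"
      by (auto simp: smult_frac intro!: frac_closed)
  next
    fix a b X assume "a \<in> carrier R" "b \<in> carrier R" "X \<in> carrier ?L"
    moreover from this obtain x s where "X = frac R M P x s" "x \<in> carrier M" "s \<in> carrier R" "s \<notin> P"
      using E by metis
    ultimately show "(a \<oplus> b) \<odot>\<^bsub>?L\<^esub> X = a \<odot>\<^bsub>?L\<^esub> X \<oplus>\<^bsub>?L\<^esub> b \<odot>\<^bsub>?L\<^esub> X"
        "(a \<otimes> b) \<odot>\<^bsub>?L\<^esub> X = a \<odot>\<^bsub>?L\<^esub> (b \<odot>\<^bsub>?L\<^esub> X)"
      using m' by (simp add: smult_frac add_frac, intro frac_eqI,
          simp_all add: smult_l_distr ac, simp add: smult_frac ac)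
  next
    fix a X Y assume "a \<in> carrier R" "X \<in> carrier ?L" "Y \<in> carrier ?L"
    moreover from this obtain x s y t where "X = frac R M P x s" "x \<in> carrier M" "s \<in> carrier R"
        "s \<notin> P" "Y = frac R M P y t" "y \<in> carrier M" "t \<in> carrier R" "t \<notin> P"
      using E by metis
    ultimately show "a \<odot>\<^bsub>?L\<^esub> (X \<oplus>\<^bsub>?L\<^esub> Y) = a \<odot>\<^bsub>?L\<^esub> X \<oplus>\<^bsub>?L\<^esub> a \<odot>\<^bsub>?L\<^esub> Y"
      using m' by (auto simp: smult_frac add_frac ac)
  next
    fix X assume "X \<in> carrier ?L"
    then obtain x s where "X = frac R M P x s" "x \<in> carrier M" "s \<in> carrier R" "s \<notin> P"
      using E by metis
    then show "\<one> \<odot>\<^bsub>?L\<^esub> X = X"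
      by (auto simp: smult_frac)
  qed
qed

end

lemma module_restrict_scalars:
  assumes "assoc_algebra R S" "left_module S M"
  shows "module R (restrict_scalars S M)"
proof -
  interpret A: assoc_algebra R S by fact
  interpret M: left_module S M by fact
  have "r \<odot>\<^bsub>S\<^esub> \<one>\<^bsub>S\<^esub> \<otimes>\<^bsub>S\<^esub> (r' \<odot>\<^bsub>S\<^esub> \<one>\<^bsub>S\<^esub>) = (r \<otimes>\<^bsub>R\<^esub> r') \<odot>\<^bsub>S\<^esub> \<one>\<^bsub>S\<^esub>"
    if "r \<in> carrier R" "r' \<in> carrier R" for r r'
    using that by (simp add: A.smult_mult_left A.smult_assoc1)
  then show ?thesis
    unfolding restrict_scalars_def
    apply (intro moduleI A.R.cring_axioms abelian_groupI)
    apply (auto simp: A.smult_l_distr M.left_smult_closed M.left_smult_l_distr M.left_smult_r_distr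
        M.left_smult_one M.left_smult_assoc[symmetric] M.M.a_ac intro: M.M.l_neg)
    done
qed

end

theory Submission
  imports "HOL-Algebra.Ring_Divisibility" Defs
begin

text \<open>If \<open>R\<close> is clean, each idempotent of \<open>R\<close> acts on an indecomposable \<open>M\<close> as \<open>0\<close> or as the
  identity, since its image in \<open>S\<close> is central. Hence for each \<open>x\<close> in \<open>R\<close>, either \<open>x\<close> or \<open>1 - x\<close> acts
  on \<open>M\<close> as a unit of \<open>R\<close>, so \<open>R / Ann M\<close> is a local ring. The preimage \<open>P\<close> of its maximal ideal is
  the only maximal ideal in the support, and all elements outside \<open>P\<close> act bijectively.

  Conversely, if \<open>x\<close> is not the sum of a unit and an idempotent, Zorn's lemma yields an ideal \<open>I\<close>
  maximal among those for which \<open>x\<close> is still not such a sum in \<open>R / I\<close>. A decomposition of \<open>R / I\<close>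
  would let one glue the decompositions of \<open>x\<close> modulo two larger ideals, so \<open>R / I\<close> is an
  indecomposable \<open>R\<close>-module. Its support contains all maximal ideals above \<open>I\<close>, so by assumption
  \<open>R / I\<close> is local. But then \<open>x\<close> or \<open>x - 1\<close> is a unit in it, a contradiction.\<close>

section \<open>Clean decompositions modulo an ideal\<close>

text \<open>This is cleanness of the residue of \<open>x\<close> in R / I, with \<open>v\<close> a
  lift of the inverse of the unit \<open>x - e\<close>. Stating it by memberships in
  \<open>I\<close> keeps all computations in \<open>R\<close>, makes passage to larger ideals
  immediate, and reduces the case of a union of ideals to two memberships.\<close>

definition clean_mod :: "('a, 'r) ring_scheme \<Rightarrow> 'a set \<Rightarrow> 'a \<Rightarrow> 'a \<Rightarrow> 'a \<Rightarrow> bool" where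
  "clean_mod R I x e v \<longleftrightarrow> e \<in> carrier R \<and> v \<in> carrier R \<and>
     e \<otimes>\<^bsub>R\<^esub> e \<ominus>\<^bsub>R\<^esub> e \<in> I \<and> (x \<ominus>\<^bsub>R\<^esub> e) \<otimes>\<^bsub>R\<^esub> v \<ominus>\<^bsub>R\<^esub> \<one>\<^bsub>R\<^esub> \<in> I"

text \<open>Both memberships are polynomial conditions on \<open>e\<close> and \<open>v\<close>, so
  they depend only on residues modulo \<open>J\<close>.\<close>

lemma (in cring) clean_mod_cong:
  assumes "ideal J R" "x \<in> carrier R" "clean_mod R J x e v"
    and c: "e' \<in> carrier R" "v' \<in> carrier R" "e' \<ominus> e \<in> J" "v' \<ominus> v \<in> J"
  shows "clean_mod R J x e' v'"
proof -
  interpret J: ideal J R by fact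
  have cc: "e \<in> carrier R" "v \<in> carrier R" and w: "e \<otimes> e \<ominus> e \<in> J" "(x \<ominus> e) \<otimes> v \<ominus> \<one> \<in> J"
    using assms(3) by (auto simp: clean_mod_def)
  have "e' \<otimes> e' \<ominus> e' = (e' \<ominus> e) \<otimes> (e' \<oplus> e \<ominus> \<one>) \<oplus> (e \<otimes> e \<ominus> e)"
    using c(1) cc by algebra
  also have "\<dots> \<in> J"
    using c cc w by (intro J.a_closed J.I_r_closed) auto
  finally have 1: "e' \<otimes> e' \<ominus> e' \<in> J" .
  have "(x \<ominus> e') \<otimes> v' \<ominus> \<one> = (x \<ominus> e) \<otimes> (v' \<ominus> v) \<oplus> (e' \<ominus> e) \<otimes> (\<ominus> v') \<oplus> ((x \<ominus> e) \<otimes> v \<ominus> \<one>)"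
    using c(1,2) cc assms(2) by algebra
  also have "\<dots> \<in> J"
    using c cc w assms(2) by (intro J.a_closed J.I_r_closed J.I_l_closed) auto
  finally show ?thesis
    using 1 c by (simp add: clean_mod_def)
qed

text \<open>Chinese remaindering: \<open>b\<close> is \<open>1\<close> modulo \<open>J\<close> and \<open>0\<close> modulo \<open>K\<close>.\<close>

lemma (in cring) clean_mod_Int:
  assumes J: "ideal J R" and K: "ideal K R" and x: "x \<in> carrier R"
    and 1: "clean_mod R J x e v" and 2: "clean_mod R K x e' v'"
    and a: "a \<in> J" and b: "b \<in> K" and ab: "a \<oplus> b = \<one>"
  shows "clean_mod R (J \<inter> K) x (b \<otimes> e \<oplus> a \<otimes> e') (b \<otimes> v \<oplus> a \<otimes> v')"
proof -
  interpret J: ideal J R by fact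
  interpret K: ideal K R by fact
  have c: "a \<in> carrier R" "b \<in> carrier R" using a b by auto
  have cc: "e \<in> carrier R" "v \<in> carrier R" "e' \<in> carrier R" "v' \<in> carrier R"
    using 1 2 by (auto simp: clean_mod_def)
  have glue: "b \<otimes> y \<oplus> a \<otimes> y' \<ominus> y \<in> J" "b \<otimes> y \<oplus> a \<otimes> y' \<ominus> y' \<in> K"
    if y: "y \<in> carrier R" "y' \<in> carrier R" for y y'
  proof -
    \<comment> \<open>Writing the subtracted \<open>y\<close> as \<open>(a + b) y\<close> turns each
      difference into a visible multiple of \<open>a\<close> or of \<open>b\<close>;
      \<open>ab\<close> removes the factor afterwards.\<close>
    have "b \<otimes> y \<oplus> a \<otimes> y' \<ominus> (a \<oplus> b) \<otimes> y = a \<otimes> (y' \<ominus> y)"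
      "b \<otimes> y \<oplus> a \<otimes> y' \<ominus> (a \<oplus> b) \<otimes> y' = b \<otimes> (y \<ominus> y')"
      using c y by algebra+
    then show "b \<otimes> y \<oplus> a \<otimes> y' \<ominus> y \<in> J" "b \<otimes> y \<oplus> a \<otimes> y' \<ominus> y' \<in> K"
      using a b y by (simp_all add: ab J.I_r_closed K.I_r_closed)
  qed
  show ?thesis
    using clean_mod_cong[OF J x 1 _ _ glue(1,1)] clean_mod_cong[OF K x 2 _ _ glue(2,2)] c cc
    by (auto simp: clean_mod_def)
qed

section \<open>Maximal ideals by Zorn's lemma\<close>

text \<open>The hypothesis on \<open>Q\<close> is a finiteness property: a chain of ideals without
  \<open>Q\<close> has a union without \<open>Q\<close>, which is what Zorn's lemma needs. It serves
  twice, for ideals that avoid 1 and for ideals modulo which a given \<open>x\<close> is not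
  clean.\<close>

lemma (in ring) maximal_ideal_avoiding:
  assumes "ideal I R" "\<not> Q I"
    and Q: "\<And>C. \<lbrakk>C \<noteq> {}; subset.chain {J. ideal J R} C; Q (\<Union>C)\<rbrakk> \<Longrightarrow> \<exists>J\<in>C. Q J"
  obtains J where "ideal J R" "I \<subseteq> J" "\<not> Q J" "\<And>K. \<lbrakk>ideal K R; J \<subset> K\<rbrakk> \<Longrightarrow> Q K"
proof -
  let ?A = "{J. ideal J R \<and> I \<subseteq> J \<and> \<not> Q J}"
  have "\<exists>M\<in>?A. \<forall>X\<in>?A. M \<subseteq> X \<longrightarrow> X = M"
  proof (rule subset_Zorn_nonempty)
    show "?A \<noteq> {}" using assms by auto
    fix C assume C: "C \<noteq> {}" "subset.chain ?A C"
    then have "subset.chain {J. ideal J R} C" and sub: "C \<subseteq> ?A"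
      by (auto simp: pred_on.chain_def)
    then show "\<Union>C \<in> ?A"
      using C(1) Q[OF C(1)] chain_Union_is_ideal[of C] by auto
  qed
  then obtain J where "J \<in> ?A" and max: "\<forall>X\<in>?A. J \<subseteq> X \<longrightarrow> X = J"
    by (elim bexE)
  then have J: "ideal J R" "I \<subseteq> J" "\<not> Q J" by simp_all
  moreover have "Q K" if "ideal K R" "J \<subset> K" for K
    using bspec[OF max, of K] that J(2) by auto
  ultimately show thesis
    by (rule that)
qed

lemma (in ring) maximalideal_above:
  assumes "ideal I R" "\<one> \<notin> I"
  obtains P where "maximalideal P R" "I \<subseteq> P"
proof -
  obtain P where P: "ideal P R" "I \<subseteq> P" "\<one> \<notin> P" "\<And>K. \<lbrakk>ideal K R; P \<subset> K\<rbrakk> \<Longrightarrow> \<one> \<in> K"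
    using maximal_ideal_avoiding[of I "\<lambda>J. \<one> \<in> J"] assms by blast
  have "maximalideal P R"
  proof (rule maximalidealI[OF P(1)])
    show "carrier R \<noteq> P" using P(3) by auto
    fix J assume "ideal J R" "P \<subseteq> J" "J \<subseteq> carrier R"
    then show "J = P \<or> J = carrier R"
      using P(4)[of J] ideal.one_imp_carrier by blast
  qed
  then show thesis using that P(2) by blast
qed

text \<open>A decomposition modulo the union of a chain involves only two memberships, witnessed by
  two members \<open>A\<close> and \<open>B\<close>. The larger of the two carries both.\<close>

lemma (in cring) clean_mod_maximal:
  assumes "x \<in> carrier R" and "\<nexists>e v. clean_mod R {\<zero>} x e v"
  obtains I where "ideal I R" "\<nexists>e v. clean_mod R I x e v"
    "\<forall>K. ideal K R \<longrightarrow> I \<subset> K \<longrightarrow> (\<exists>e v. clean_mod R K x e v)"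
proof -
  let ?Q = "\<lambda>I. \<exists>e v. clean_mod R I x e v"
  have "\<exists>J\<in>C. ?Q J" if C: "subset.chain {J. ideal J R} C" "?Q (\<Union>C)" for C
  proof -
    obtain e v where "clean_mod R (\<Union>C) x e v" using C(2) by blast
    then obtain A B where "e \<in> carrier R" "v \<in> carrier R" "A \<in> C" "B \<in> C"
        "e \<otimes> e \<ominus> e \<in> A" "(x \<ominus> e) \<otimes> v \<ominus> \<one> \<in> B"
      unfolding clean_mod_def by blast
    moreover have "A \<subseteq> B \<or> B \<subseteq> A"
      using C(1) \<open>A \<in> C\<close> \<open>B \<in> C\<close> by (auto simp: pred_on.chain_def)
    ultimately show ?thesis
      unfolding clean_mod_def by blast
  qed
  then show thesis
    by (rule maximal_ideal_avoiding[of _ ?Q, OF zeroideal assms(2)]) (assumption | rule that | intro allI impI)+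
qed

lemma (in cring) clean_ringI:
  assumes "\<And>x. x \<in> carrier R \<Longrightarrow> \<exists>e v. clean_mod R {\<zero>} x e v"
  shows "clean_ring R"
  unfolding clean_ring_def
proof
  fix x assume x: "x \<in> carrier R"
  then obtain e v where c: "e \<in> carrier R" "v \<in> carrier R"
    and "e \<otimes> e \<ominus> e = \<zero>" "(x \<ominus> e) \<otimes> v \<ominus> \<one> = \<zero>"
    using assms[OF x] unfolding clean_mod_def by blast
  then have e: "e \<otimes> e = e" and v: "(x \<ominus> e) \<otimes> v = \<one>"
    using r_right_minus_eq[of "e \<otimes> e" e] r_right_minus_eq[of "(x \<ominus> e) \<otimes> v" \<one>] x c
    by (metis m_closed minus_closed one_closed)+
  have "x \<ominus> e \<in> Units R"
    using minus_closed[OF x c(1)] c(2) v m_comm[of v "x \<ominus> e"] by (auto simp: Units_def)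
  moreover have "x = (x \<ominus> e) \<oplus> e"
    using x c by algebra
  ultimately show "\<exists>u\<in>Units R. \<exists>e\<in>carrier R. e \<otimes> e = e \<and> x = u \<oplus> e"
    using c e by blast
qed

section \<open>The support in terms of annihilators\<close>

lemma (in module_at_prime) frac_eq_zero_iff:
  assumes "x \<in> carrier M" "s \<in> carrier R - P"
  shows "frac R M P x s = \<zero>\<^bsub>localization R M P\<^esub> \<longleftrightarrow> (\<exists>w \<in> carrier R - P. w \<odot>\<^bsub>M\<^esub> x = \<zero>\<^bsub>M\<^esub>)"
  unfolding zero_localization using assms one_not_in_P by (simp add: frac_eq_iff)

text \<open>Whether a fraction vanishes does not depend on its denominator. Hence membership in the
  support can be tested on elements of \<open>M\<close>: one of them must have its annihilator
  inside \<open>P\<close>.\<close>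

lemma (in module_at_prime) mem_Supp_iff:
  "P \<in> Supp R M \<longleftrightarrow> (\<exists>x \<in> carrier M. \<forall>w \<in> carrier R - P. w \<odot>\<^bsub>M\<^esub> x \<noteq> \<zero>\<^bsub>M\<^esub>)"
proof -
  have "P \<in> Supp R M \<longleftrightarrow> (\<exists>X \<in> carrier (localization R M P). X \<noteq> \<zero>\<^bsub>localization R M P\<^esub>)"
    using frac_closed[OF M.zero_closed one_not_in_P] primeideal_axioms
    by (auto simp: Supp_def zero_localization)
  also have "\<dots> \<longleftrightarrow> (\<exists>x \<in> carrier M. \<exists>s \<in> carrier R - P. frac R M P x s \<noteq> \<zero>\<^bsub>localization R M P\<^esub>)"
    unfolding carrier_localization by blast
  also have "\<dots> \<longleftrightarrow> (\<exists>x \<in> carrier M. \<forall>w \<in> carrier R - P. w \<odot>\<^bsub>M\<^esub> x \<noteq> \<zero>\<^bsub>M\<^esub>)"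
    using frac_eq_zero_iff one_not_in_P by blast
  finally show ?thesis .
qed

section \<open>The quotient R / I as a module on prescribed types\<close>

text \<open>The converse direction may apply its assumption only to algebras on \<open>'s\<close>
  and modules on \<open>'m\<close>, so \<open>R\<close> and R / I must be rebuilt there. The map
  \<open>i\<close> encodes elements of \<open>R\<close>, while \<open>q\<close> encodes residue
  classes: its fibres over \<open>carrier R\<close> are exactly the cosets of
  \<open>I\<close>.\<close>

locale transported_quotient = cring R + ideal I R
  for R :: "('a, 'r) ring_scheme" (structure) and I +
  fixes i :: "'a \<Rightarrow> 's" and q :: "'a \<Rightarrow> 'm"
  assumes inj: "inj_on i (carrier R)"
    and q_eq_iff: "\<lbrakk>a \<in> carrier R; b \<in> carrier R\<rbrakk> \<Longrightarrow> q a = q b \<longleftrightarrow> a \<ominus> b \<in> I"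
begin

text \<open>On encoded elements \<open>h\<close> undoes \<open>i\<close> exactly, but
  \<open>g\<close> only selects some representative of a class. The operations of \<open>quo\<close>
  are therefore computed up to an error in \<open>I\<close>.\<close>

abbreviation h where "h \<equiv> inv_into (carrier R) i"
abbreviation g where "g \<equiv> inv_into (carrier R) q"

text \<open>Copies of \<open>R\<close> as an algebra over itself and of \<open>R / I\<close> as a module over it, transported to the
  prescribed types \<open>'s\<close> and \<open>'m\<close>.\<close>

definition alg :: "('a, 's) module" where
  "alg = \<lparr>carrier = i ` carrier R, monoid.mult = (\<lambda>s t. i (h s \<otimes> h t)), one = i \<one>, zero = i \<zero>,
     add = (\<lambda>s t. i (h s \<oplus> h t)), smult = (\<lambda>a s. i (a \<otimes> h s))\<rparr>"

definition quo :: "('s, 'm) module" where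
  "quo = \<lparr>carrier = q ` carrier R, monoid.mult = undefined, one = undefined, zero = q \<zero>,
     add = (\<lambda>X Y. q (g X \<oplus> g Y)), smult = (\<lambda>s X. q (h s \<otimes> g X))\<rparr>"

lemma h_i: "a \<in> carrier R \<Longrightarrow> h (i a) = a"
  using inj by simp

lemma g_q: "a \<in> carrier R \<Longrightarrow> g (q a) \<in> carrier R \<and> g (q a) \<ominus> a \<in> I"
  by (metis q_eq_iff f_inv_into_f imageI inv_into_into)

lemma q_eqI: "\<lbrakk>a \<ominus> b = c; c \<in> I; a \<in> carrier R; b \<in> carrier R\<rbrakk> \<Longrightarrow> q a = q b"
  using q_eq_iff by simp

lemma alg_simps:
  "carrier alg = i ` carrier R" "\<one>\<^bsub>alg\<^esub> = i \<one>" "\<zero>\<^bsub>alg\<^esub> = i \<zero>"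
  "\<lbrakk>a \<in> carrier R; b \<in> carrier R\<rbrakk> \<Longrightarrow> i a \<otimes>\<^bsub>alg\<^esub> i b = i (a \<otimes> b)"
  "\<lbrakk>a \<in> carrier R; b \<in> carrier R\<rbrakk> \<Longrightarrow> i a \<oplus>\<^bsub>alg\<^esub> i b = i (a \<oplus> b)"
  "\<lbrakk>a \<in> carrier R; b \<in> carrier R\<rbrakk> \<Longrightarrow> a \<odot>\<^bsub>alg\<^esub> i b = i (a \<otimes> b)"
  by (simp_all add: alg_def h_i)

lemma quo_simps:
  "carrier quo = q ` carrier R" "\<zero>\<^bsub>quo\<^esub> = q \<zero>"
  by (simp_all add: quo_def)

lemma quo_add:
  assumes "a \<in> carrier R" "b \<in> carrier R"
  shows "q a \<oplus>\<^bsub>quo\<^esub> q b = q (a \<oplus> b)"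
proof -
  note g = g_q[OF assms(1)] g_q[OF assms(2)]
  have "(g (q a) \<oplus> g (q b)) \<ominus> (a \<oplus> b) = (g (q a) \<ominus> a) \<oplus> (g (q b) \<ominus> b)"
    using g[THEN conjunct1] assms by algebra
  then show ?thesis
    unfolding quo_def using g assms by (auto intro!: q_eqI)
qed

lemma quo_smult:
  assumes "a \<in> carrier R" "b \<in> carrier R"
  shows "i a \<odot>\<^bsub>quo\<^esub> q b = q (a \<otimes> b)"
proof -
  note g = g_q[OF assms(2)]
  have "(a \<otimes> g (q b)) \<ominus> (a \<otimes> b) = a \<otimes> (g (q b) \<ominus> b)"
    using g[THEN conjunct1] assms by algebra
  then show ?thesis
    unfolding quo_def using g assms by (auto simp: h_i intro!: q_eqI I_l_closed)
qed

lemma ring_alg: "ring alg"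
proof (rule ringI)
  show "abelian_group alg"
  proof (rule abelian_groupI)
    fix x assume "x \<in> carrier alg"
    then obtain a where a: "a \<in> carrier R" "x = i a" by (auto simp: alg_simps)
    then show "\<exists>y\<in>carrier alg. y \<oplus>\<^bsub>alg\<^esub> x = \<zero>\<^bsub>alg\<^esub>"
      by (auto simp: alg_simps l_neg intro!: bexI[of _ "\<ominus> a"])
  qed (auto simp: alg_simps a_ac)
  show "monoid alg"
    by (rule monoidI) (auto simp: alg_simps m_assoc)
qed (auto simp: alg_simps l_distr r_distr)

lemma assoc_algebra_alg: "assoc_algebra R alg"
proof -
  interpret A: ring alg by (rule ring_alg)
  have "Module.module R alg"
    by (rule moduleI)
      (auto simp: is_cring A.abelian_group_axioms alg_simps m_assoc l_distr r_distr)
  then show ?thesis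
    by (intro assoc_algebra.intro assoc_algebra_axioms.intro ring_alg)
      (auto simp: alg_simps m_ac)
qed

lemma left_module_quo: "left_module alg quo"
proof (intro left_module.intro left_module_axioms.intro ring_alg)
  show "abelian_group quo"
  proof (rule abelian_groupI)
    fix x assume "x \<in> carrier quo"
    then obtain a where a: "a \<in> carrier R" "x = q a" by (auto simp: quo_simps)
    then show "\<exists>y\<in>carrier quo. y \<oplus>\<^bsub>quo\<^esub> x = \<zero>\<^bsub>quo\<^esub>"
      using quo_add[of "\<ominus> a" a] by (intro bexI[of _ "q (\<ominus> a)"]) (auto simp: quo_simps l_neg)
  qed (auto simp: quo_simps quo_add a_ac)
qed (auto simp: alg_simps quo_simps quo_add quo_smult m_assoc l_distr r_distr)

text \<open>Since \<open>alg\<close> is a copy of \<open>R\<close>, its submodules of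
  \<open>quo\<close> are closed under all scalars from \<open>R\<close>. This is half of the
  correspondence between submodules of R / I and ideals above \<open>I\<close>.\<close>

lemma ideal_vimage:
  assumes "submodule A alg quo"
  shows "ideal {a \<in> carrier R. q a \<in> A} R"
proof -
  interpret A: submodule A alg quo by fact
  interpret L: left_module alg quo by (rule left_module_quo)
  have 0: "q \<zero> \<in> A"
    using A.one_closed by (simp add: quo_simps)
  have add: "q (a \<oplus> b) \<in> A" if "a \<in> carrier R" "b \<in> carrier R" "q a \<in> A" "q b \<in> A" for a b
    using A.m_closed[of "q a" "q b"] that by (simp add: quo_add)
  have mult: "q (a \<otimes> b) \<in> A" if "a \<in> carrier R" "b \<in> carrier R" "q b \<in> A" for a b
    using A.smult_closed[of "i a" "q b"] that by (simp add: quo_smult alg_simps)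
  have mult': "q (b \<otimes> a) \<in> A" if "a \<in> carrier R" "b \<in> carrier R" "q b \<in> A" for a b
    using mult[OF that] m_comm[OF that(1,2)] by simp
  show ?thesis
  proof (rule idealI)
    show "subgroup {a \<in> carrier R. q a \<in> A} (add_monoid R)"
    proof (rule add.subgroupI)
      fix a assume "a \<in> {a \<in> carrier R. q a \<in> A}"
      then show "\<ominus> a \<in> {a \<in> carrier R. q a \<in> A}"
        using mult[of "\<ominus> \<one>" a] by (simp add: l_minus)
    qed (use 0 add in auto)
  qed (use mult mult' ring_axioms in auto)
qed

text \<open>For a decomposition into nonzero \<open>A\<close> and \<open>B\<close>, both preimages
  properly contain \<open>I\<close>, so \<open>x\<close> is clean modulo each. They are comaximal
  because \<open>A\<close> and \<open>B\<close> span, and they meet inside \<open>I\<close> because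
  \<open>A\<close> and \<open>B\<close> meet trivially. Chinese remaindering then makes
  \<open>x\<close> clean modulo \<open>I\<close>, a contradiction.\<close>

lemma indecomposable_quo:
  assumes "x \<in> carrier R" "\<nexists>e v. clean_mod R I x e v"
    "\<forall>K. ideal K R \<longrightarrow> I \<subset> K \<longrightarrow> (\<exists>e v. clean_mod R K x e v)"
  shows "indecomposable_module alg quo"
  unfolding indecomposable_module_def
proof (intro conjI allI impI left_module_quo)
  \<comment> \<open>If 1 were in \<open>I\<close>, then \<open>I\<close> would be all of
    \<open>carrier R\<close> and every choice of \<open>e\<close> and \<open>v\<close> would
    decompose \<open>x\<close>.\<close>
  have "\<one> \<notin> I"
    using assms(1,2) one_imp_carrier unfolding clean_mod_def
    by (metis m_closed minus_closed zero_closed one_closed)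
  then show "carrier quo \<noteq> {\<zero>\<^bsub>quo\<^esub>}"
    using q_eq_iff[of \<one> \<zero>] by (auto simp: quo_simps a_minus_def)
next
  fix A B
  assume AB: "submodule A alg quo \<and> submodule B alg quo \<and>
    A \<inter> B = {\<zero>\<^bsub>quo\<^esub>} \<and> A <+>\<^bsub>quo\<^esub> B = carrier quo"
  let ?J = "\<lambda>A. {a \<in> carrier R. q a \<in> A}"
  have larger: "I \<subset> ?J A" if A: "submodule A alg quo" "A \<noteq> {\<zero>\<^bsub>quo\<^esub>}" for A
  proof -
    interpret A: submodule A alg quo by fact
    have 0: "q \<zero> \<in> A"
      using A.one_closed by (simp add: quo_simps)
    have "I \<subseteq> ?J A"
    proof
      fix a assume "a \<in> I"
      then show "a \<in> ?J A"
        using q_eq_iff[of a \<zero>] 0 Icarr by (auto simp: a_minus_def)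
    qed
    moreover obtain X where X: "X \<in> A" "X \<noteq> q \<zero>"
      using A(2) 0 by (auto simp: quo_simps)
    moreover from X obtain a where a: "a \<in> carrier R" "X = q a"
      using A.subset by (auto simp: quo_simps)
    ultimately have "a \<in> ?J A - I"
      using q_eq_iff[of a \<zero>] by (auto simp: a_minus_def)
    with \<open>I \<subseteq> ?J A\<close> show ?thesis by blast
  qed
  show "A = {\<zero>\<^bsub>quo\<^esub>} \<or> B = {\<zero>\<^bsub>quo\<^esub>}"
  proof (rule ccontr)
    assume "\<not> ?thesis"
    then have I: "I \<subset> ?J A" "I \<subset> ?J B"
      using larger AB by auto
    then obtain e v e' v' where w: "clean_mod R (?J A) x e v" "clean_mod R (?J B) x e' v'"
      using AB ideal_vimage assms(3) by meson
    have "q \<one> \<in> A <+>\<^bsub>quo\<^esub> B"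
      using AB by (simp add: quo_simps)
    then obtain X Y where XY: "X \<in> A" "Y \<in> B" "q \<one> = X \<oplus>\<^bsub>quo\<^esub> Y"
      by (auto simp: set_add_def')
    have "C \<subseteq> q ` carrier R" if "submodule C alg quo" for C
      using subgroup.subset[OF submodule.axioms(1)[OF that]] by (simp add: quo_simps)
    then have "X \<in> q ` carrier R" "Y \<in> q ` carrier R"
      using AB XY(1,2) by (meson subsetD)+
    then obtain a b where c: "a \<in> carrier R" "b \<in> carrier R" "X = q a" "Y = q b"
      by (elim imageE)
    with XY have ab: "a \<in> ?J A" "b \<in> ?J B" "q \<one> = q (a \<oplus> b)"
      by (simp_all add: quo_add)
    have sub: "?J A \<inter> ?J B \<subseteq> I"
    proof
      fix a assume "a \<in> ?J A \<inter> ?J B"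
      then have "a \<in> carrier R" "q a \<in> A \<inter> B" by auto
      then show "a \<in> I"
        using AB q_eq_iff[of a \<zero>] by (simp add: quo_simps a_minus_def)
    qed
    have idl: "ideal (?J A) R" "ideal (?J B) R"
      using AB ideal_vimage by simp_all
    \<comment> \<open>So far \<open>a + b\<close> is 1 only modulo \<open>I\<close>. The error lies
      in \<open>I\<close>, hence in the preimage of \<open>A\<close>, and is absorbed into the first
      summand to give the exact equation that \<open>clean_mod_Int\<close> requires.\<close>
    have "\<one> \<ominus> (a \<oplus> b) \<in> I"
      using ab(3) c(1,2) q_eq_iff[of \<one> "a \<oplus> b"] by simp
    then have "a \<oplus> (\<one> \<ominus> (a \<oplus> b)) \<in> ?J A"
      using I(1) ab(1) by (intro additive_subgroup.a_closed ideal.axioms(1) idl) auto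
    moreover have "a \<oplus> (\<one> \<ominus> (a \<oplus> b)) \<oplus> b = \<one>"
      using c(1,2) by algebra
    ultimately have "\<exists>e v. clean_mod R (?J A \<inter> ?J B) x e v"
      using clean_mod_Int[OF idl assms(1) w _ ab(2)] by blast
    then show False
      using sub assms(2) unfolding clean_mod_def by blast
  qed
qed

lemma smult_restrict_quo:
  "\<lbrakk>a \<in> carrier R; b \<in> carrier R\<rbrakk> \<Longrightarrow> a \<odot>\<^bsub>restrict_scalars alg quo\<^esub> q b = q (a \<otimes> b)"
  by (simp add: restrict_scalars_def alg_simps quo_smult)

text \<open>The class of 1 has annihilator \<open>I\<close>, which lies in \<open>P\<close>.\<close>

lemma maximalideal_in_Supp_quo:
  assumes "maximalideal P R" "I \<subseteq> P"
  shows "P \<in> Supp R (restrict_scalars alg quo)"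
proof -
  let ?N = "restrict_scalars alg quo"
  interpret P: primeideal P R
    by (rule maximalideal_prime) fact
  interpret N: Module.module R ?N
    by (rule module_restrict_scalars[OF assoc_algebra_alg left_module_quo])
  interpret L: module_at_prime R ?N P ..
  have "w \<odot>\<^bsub>?N\<^esub> q \<one> \<noteq> \<zero>\<^bsub>?N\<^esub>" if "w \<in> carrier R - P" for w
    using that assms(2) q_eq_iff[of w \<zero>]
    by (auto simp: smult_restrict_quo) (auto simp: restrict_scalars_def quo_simps a_minus_def)
  moreover have "q \<one> \<in> carrier ?N"
    by (simp add: restrict_scalars_def quo_simps)
  ultimately show ?thesis
    using L.mem_Supp_iff by blast
qed

end

section \<open>Unique maximal ideals in supports imply cleanness\<close>

lemma (in cring) clean_ring_if_indecomposable_local: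
  fixes i :: "'a \<Rightarrow> 's" and j :: "'a \<Rightarrow> 'm"
  assumes i: "inj_on i (carrier R)" and j: "inj_on j (carrier R)"
    and local: "\<And>(S :: ('a, 's) module) (M :: ('s, 'm) module).
      \<lbrakk>assoc_algebra R S; indecomposable_module S M\<rbrakk> \<Longrightarrow>
      \<exists>!P. P \<in> Supp R (restrict_scalars S M) \<and> maximalideal P R"
  shows "clean_ring R"
proof (rule clean_ringI, rule ccontr)
  fix x assume x: "x \<in> carrier R" and "\<nexists>e v. clean_mod R {\<zero>} x e v"
  then obtain I where I: "ideal I R" "\<nexists>e v. clean_mod R I x e v"
    "\<forall>K. ideal K R \<longrightarrow> I \<subset> K \<longrightarrow> (\<exists>e v. clean_mod R K x e v)"
    using clean_mod_maximal[OF x] by blast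
  interpret I: ideal I R by fact
  let ?C = "\<lambda>a. {c \<in> carrier R. a \<ominus> c \<in> I}"
  \<comment> \<open>\<open>?C a\<close> is the coset of \<open>a\<close>. The choice depends only on
    the coset, so composing it with \<open>j\<close> encodes R / I in \<open>'m\<close>.\<close>
  define q where "q a = j (SOME c. c \<in> ?C a)" for a
  have "transported_quotient R I i q"
  proof (intro transported_quotient.intro transported_quotient_axioms.intro is_cring I(1) i)
    fix a b assume ab: "a \<in> carrier R" "b \<in> carrier R"
    have some: "(SOME c. c \<in> ?C a) \<in> ?C a" if "a \<in> carrier R" for a
      by (rule someI[of "\<lambda>c. c \<in> ?C a" a]) (simp add: that a_minus_def r_neg)
    show "q a = q b \<longleftrightarrow> a \<ominus> b \<in> I"
    proof
      assume "q a = q b"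
      then have "(SOME c. c \<in> ?C a) = (SOME c. c \<in> ?C b)"
        using j some[OF ab(1)] some[OF ab(2)] by (simp add: q_def inj_on_def)
      then obtain c where c: "c \<in> carrier R" "a \<ominus> c \<in> I" "b \<ominus> c \<in> I"
        using some[OF ab(1)] some[OF ab(2)] by auto
      then have "(a \<ominus> c) \<oplus> (\<ominus> (b \<ominus> c)) \<in> I" by blast
      moreover have "(a \<ominus> c) \<oplus> (\<ominus> (b \<ominus> c)) = a \<ominus> b"
        using c(1) ab by algebra
      ultimately show "a \<ominus> b \<in> I" by simp
    next
      assume d: "a \<ominus> b \<in> I"
      have "a \<ominus> c \<in> I \<longleftrightarrow> b \<ominus> c \<in> I" if c: "c \<in> carrier R" for c
      proof -
        have "a \<ominus> c = (a \<ominus> b) \<oplus> (b \<ominus> c)" "b \<ominus> c = (\<ominus> (a \<ominus> b)) \<oplus> (a \<ominus> c)"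
          using c ab by algebra+
        then show ?thesis
          using d I.a_closed I.a_inv_closed by metis
      qed
      then have "?C a = ?C b" by auto
      then show "q a = q b" by (simp add: q_def)
    qed
  qed
  then interpret T: transported_quotient R I i q .
  have ex1: "\<exists>!P. P \<in> Supp R (restrict_scalars T.alg T.quo) \<and> maximalideal P R"
    by (rule local[OF T.assoc_algebra_alg T.indecomposable_quo[OF x I(2,3)]])
  \<comment> \<open>An element \<open>y\<close> that is not a unit modulo \<open>I\<close> generates
    with \<open>I\<close> a proper ideal, which lies in a maximal one.\<close>
  have above: "\<exists>P. maximalideal P R \<and> I \<subseteq> P \<and> y \<in> P"
    if y: "y \<in> carrier R" and no: "\<And>v. v \<in> carrier R \<Longrightarrow> y \<otimes> v \<ominus> \<one> \<notin> I" for y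
  proof -
    let ?K = "I <+>\<^bsub>R\<^esub> PIdl y"
    have K: "ideal ?K R"
      by (rule add_ideals[OF I(1) cgenideal_ideal[OF y]])
    have "\<one> \<notin> ?K"
    proof
      assume "\<one> \<in> ?K"
      then obtain c v where cv: "c \<in> I" "v \<in> carrier R" "\<one> = c \<oplus> v \<otimes> y"
        by (auto simp: set_add_def' cgenideal_def)
      then have "y \<otimes> v \<ominus> (c \<oplus> v \<otimes> y) = \<ominus> c"
        using y I.Icarr[OF cv(1)] by algebra
      then show False
        using no[OF cv(2)] cv by (metis I.a_inv_closed)
    qed
    then obtain P where P: "maximalideal P R" "?K \<subseteq> P"
      using maximalideal_above[OF K] by blast
    have "\<zero> \<in> PIdl y"
      using additive_subgroup.zero_closed[OF ideal.axioms(1)[OF cgenideal_ideal[OF y]]] .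
    then have "c \<oplus> \<zero> \<in> ?K" if "c \<in> I" for c
      using that unfolding set_add_def' by blast
    then have "I \<subseteq> ?K"
      by (auto dest: I.Icarr)
    moreover have "\<zero> \<oplus> y \<in> ?K"
      using cgenideal_self[OF y] I.zero_closed unfolding set_add_def' by blast
    then have "y \<in> ?K"
      using y by simp
    ultimately show ?thesis using P by blast
  qed
  \<comment> \<open>Neither \<open>x\<close> nor \<open>x - 1\<close> is a unit modulo
    \<open>I\<close>: the trivial idempotents 0 and 1 would give a clean decomposition of
    \<open>x\<close>.\<close>
  have 0: "x \<otimes> v \<ominus> \<one> \<notin> I" if "v \<in> carrier R" for v
  proof
    assume "x \<otimes> v \<ominus> \<one> \<in> I"
    then have "clean_mod R I x \<zero> v"
      using x that by (simp add: clean_mod_def a_minus_def)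
    then show False using I(2) by blast
  qed
  have 1: "(x \<ominus> \<one>) \<otimes> v \<ominus> \<one> \<notin> I" if "v \<in> carrier R" for v
  proof
    assume "(x \<ominus> \<one>) \<otimes> v \<ominus> \<one> \<in> I"
    moreover have "\<one> \<ominus> \<one> \<in> I"
      by (simp add: a_minus_def r_neg)
    ultimately have "clean_mod R I x \<one> v"
      using x that by (simp add: clean_mod_def)
    then show False using I(2) by blast
  qed
  obtain P where P: "maximalideal P R" "I \<subseteq> P" "x \<in> P"
    using above[OF x 0] by blast
  obtain P' where P': "maximalideal P' R" "I \<subseteq> P'" "x \<ominus> \<one> \<in> P'"
    using above[OF _ 1] x by blast
  \<comment> \<open>Both maximal ideals contain \<open>I\<close>, so both lie in the support and
    coincide; the common ideal then contains \<open>x\<close> and \<open>x - 1\<close>, hence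
    1.\<close>
  have eq: "P' = P"
    using ex1 T.maximalideal_in_Supp_quo P P' by blast
  interpret P: maximalideal P R by fact
  have "x \<oplus> (\<ominus> (x \<ominus> \<one>)) \<in> P"
    using P(3) P'(3) eq by blast
  moreover have "x \<oplus> (\<ominus> (x \<ominus> \<one>)) = \<one>"
    using x by algebra
  ultimately show False
    using P.I_notcarr P.one_imp_carrier by simp
qed

section \<open>Modules on which the ring acts through a local quotient\<close>

context Module.module
begin

text \<open>The inverse has to come from \<open>R\<close>: acting bijectively is weaker, e.g. for the integers localized
  at \<open>p\<close> acting on the rationals, and the non-bijective elements need not form a maximal ideal.\<close>

definition acts_invertibly :: "'a \<Rightarrow> bool" where
  "acts_invertibly x \<longleftrightarrow> (\<exists>y\<in>carrier R. \<forall>m\<in>carrier M. (x \<otimes> y) \<odot>\<^bsub>M\<^esub> m = m)"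

definition noninvertible :: "'a set" where
  "noninvertible = {x \<in> carrier R. \<not> acts_invertibly x}"

end

text \<open>\<open>acts_invertibly x\<close> says that \<open>x\<close> is a unit modulo Ann M, so
  the assumptions express that R / Ann M is a local ring, and \<open>noninvertible\<close> is the
  preimage of its nonunits. All that cleanness contributes to the support and to the localization
  passes through this locale.\<close>

locale local_action = Module.module +
  assumes nonzero: "carrier M \<noteq> {\<zero>\<^bsub>M\<^esub>}"
    and invertible_or: "x \<in> carrier R \<Longrightarrow> acts_invertibly x \<or> acts_invertibly (\<one> \<ominus> x)"
begin

text \<open>This places Ann M inside \<open>noninvertible\<close>: an inverse of an annihilating
  element would force \<open>M\<close> to be zero.\<close>

lemma not_acts_invertibly:
  assumes "x \<in> carrier R" "\<And>m. m \<in> carrier M \<Longrightarrow> x \<odot>\<^bsub>M\<^esub> m = \<zero>\<^bsub>M\<^esub>"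
  shows "\<not> acts_invertibly x"
proof
  assume "acts_invertibly x"
  then obtain y where y: "y \<in> carrier R" "\<And>m. m \<in> carrier M \<Longrightarrow> (x \<otimes> y) \<odot>\<^bsub>M\<^esub> m = m"
    by (auto simp: acts_invertibly_def)
  have "m = \<zero>\<^bsub>M\<^esub>" if "m \<in> carrier M" for m
    using y(2)[OF that] smult_assoc1[OF assms(1) y(1) that] assms(2)[of "y \<odot>\<^bsub>M\<^esub> m"] y(1) that
    by simp
  then show False using nonzero M.zero_closed by blast
qed

lemma acts_invertibly_multD:
  assumes "acts_invertibly (x \<otimes> r)" "x \<in> carrier R" "r \<in> carrier R"
  shows "acts_invertibly x"
proof -
  obtain y where "y \<in> carrier R" "\<And>m. m \<in> carrier M \<Longrightarrow> (x \<otimes> r \<otimes> y) \<odot>\<^bsub>M\<^esub> m = m"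
    using assms(1) by (auto simp: acts_invertibly_def)
  then show ?thesis
    unfolding acts_invertibly_def using assms(2,3) by (intro bexI[of _ "r \<otimes> y"]) (auto simp: m_assoc)
qed

text \<open>After scaling by \<open>y\<close>, the sum \<open>a y + b y\<close> acts as the
  identity, so \<open>b y\<close> acts as \<open>1 - a y\<close>. One of \<open>a y\<close> and
  \<open>1 - a y\<close> is invertible, and a factor of an invertible product is invertible.\<close>

lemma acts_invertibly_addD:
  assumes "acts_invertibly (a \<oplus> b)" and ab: "a \<in> carrier R" "b \<in> carrier R"
  shows "acts_invertibly a \<or> acts_invertibly b"
proof -
  obtain y where y: "y \<in> carrier R" "\<And>m. m \<in> carrier M \<Longrightarrow> ((a \<oplus> b) \<otimes> y) \<odot>\<^bsub>M\<^esub> m = m"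
    using assms(1) by (auto simp: acts_invertibly_def)
  show ?thesis
  proof (cases "acts_invertibly (a \<otimes> y)")
    case True
    then show ?thesis using acts_invertibly_multD ab y(1) by blast
  next
    case False
    then obtain z where z: "z \<in> carrier R"
        "\<And>m. m \<in> carrier M \<Longrightarrow> ((\<one> \<ominus> a \<otimes> y) \<otimes> z) \<odot>\<^bsub>M\<^esub> m = m"
      using invertible_or[of "a \<otimes> y"] ab y(1) by (auto simp: acts_invertibly_def)
    have "(b \<otimes> (y \<otimes> z)) \<odot>\<^bsub>M\<^esub> m = m" if m: "m \<in> carrier M" for m
    proof -
      have "(b \<otimes> (y \<otimes> z)) = ((a \<oplus> b) \<otimes> y) \<otimes> z \<oplus> (\<ominus> ((a \<otimes> y) \<otimes> z))"
        using ab y(1) z(1) by algebra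
      then have "(b \<otimes> (y \<otimes> z)) \<odot>\<^bsub>M\<^esub> m =
          ((a \<oplus> b) \<otimes> y) \<odot>\<^bsub>M\<^esub> (z \<odot>\<^bsub>M\<^esub> m) \<oplus>\<^bsub>M\<^esub> (\<ominus> ((a \<otimes> y) \<otimes> z)) \<odot>\<^bsub>M\<^esub> m"
        using ab y(1) z(1) m by (simp add: smult_l_distr smult_assoc1)
      also have "\<dots> = (z \<oplus> (\<ominus> ((a \<otimes> y) \<otimes> z))) \<odot>\<^bsub>M\<^esub> m"
        using ab y z(1) m by (simp add: smult_l_distr)
      also have "z \<oplus> (\<ominus> ((a \<otimes> y) \<otimes> z)) = (\<one> \<ominus> a \<otimes> y) \<otimes> z"
        using ab y(1) z(1) by algebra
      finally show ?thesis using z(2) m by simp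
    qed
    then show ?thesis
      unfolding acts_invertibly_def using y(1) z(1) by blast
  qed
qed

lemma ideal_noninvertible: "ideal noninvertible R"
proof (rule idealI)
  have mult: "x \<otimes> r \<in> noninvertible" if "x \<in> noninvertible" "r \<in> carrier R" for x r
    using that acts_invertibly_multD by (auto simp: noninvertible_def)
  show "subgroup noninvertible (add_monoid R)"
  proof (rule R.add.subgroupI)
    show "noninvertible \<noteq> {}"
      using not_acts_invertibly[of \<zero>] by (auto simp: noninvertible_def)
    fix a assume a: "a \<in> noninvertible"
    then have "a \<otimes> (\<ominus> \<one>) = \<ominus> a"
      by (simp add: noninvertible_def R.r_minus)
    with mult[OF a, of "\<ominus> \<one>"] show "\<ominus> a \<in> noninvertible" by simp
  qed (use acts_invertibly_addD in \<open>auto simp: noninvertible_def\<close>)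
  fix a x assume "a \<in> noninvertible" "x \<in> carrier R"
  with mult[OF this] show "a \<otimes> x \<in> noninvertible" "x \<otimes> a \<in> noninvertible"
    using R.m_comm[of x a] by (auto simp: noninvertible_def)
qed (rule R.ring_axioms)

lemma complement_noninvertible:
  assumes "w \<in> carrier R - noninvertible"
  shows "\<exists>y\<in>carrier R. \<forall>m\<in>carrier M. w \<odot>\<^bsub>M\<^esub> (y \<odot>\<^bsub>M\<^esub> m) = m \<and> y \<odot>\<^bsub>M\<^esub> (w \<odot>\<^bsub>M\<^esub> m) = m"
proof -
  have w: "w \<in> carrier R" using assms by simp
  obtain y where y: "y \<in> carrier R" "\<And>m. m \<in> carrier M \<Longrightarrow> (w \<otimes> y) \<odot>\<^bsub>M\<^esub> m = m"
    using assms by (auto simp: noninvertible_def acts_invertibly_def)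
  then show ?thesis
    using w R.m_comm[OF w y(1)] by (intro bexI[of _ y]) (simp_all flip: smult_assoc1)
qed

text \<open>An ideal that contains \<open>w\<close> and Ann M contains 1. This argument yields the
  maximality of \<open>noninvertible\<close>, and a variant with the annihilator of a single element
  yields uniqueness in the support.\<close>

lemma one_minus_annihilates:
  assumes "w \<in> carrier R - noninvertible"
  shows "\<exists>y\<in>carrier R. \<forall>m\<in>carrier M. (\<one> \<ominus> w \<otimes> y) \<odot>\<^bsub>M\<^esub> m = \<zero>\<^bsub>M\<^esub>"
proof -
  obtain y where y: "y \<in> carrier R" "\<forall>m\<in>carrier M. w \<odot>\<^bsub>M\<^esub> (y \<odot>\<^bsub>M\<^esub> m) = m"
    using complement_noninvertible[OF assms] by auto
  then show ?thesis
    using assms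
    by (intro bexI[of _ y]) (simp_all add: R.minus_eq smult_l_distr smult_l_minus smult_assoc1 M.r_neg)
qed

lemma maximalideal_noninvertible: "maximalideal noninvertible R"
proof (rule maximalidealI[OF ideal_noninvertible])
  have "acts_invertibly \<one>"
    unfolding acts_invertibly_def by (intro bexI[of _ \<one>]) auto
  then show "carrier R \<noteq> noninvertible"
    by (auto simp: noninvertible_def)
next
  fix J assume J: "ideal J R" "noninvertible \<subseteq> J" "J \<subseteq> carrier R"
  interpret J: ideal J R by fact
  show "J = noninvertible \<or> J = carrier R"
  proof (rule ccontr)
    assume n: "\<not> ?thesis"
    then obtain x where x: "x \<in> J" "x \<in> carrier R - noninvertible"
      using J by blast
    obtain y where y: "y \<in> carrier R" "\<forall>m\<in>carrier M. (\<one> \<ominus> x \<otimes> y) \<odot>\<^bsub>M\<^esub> m = \<zero>\<^bsub>M\<^esub>"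
      using one_minus_annihilates[OF x(2)] by blast
    \<comment> \<open>The element annihilates \<open>M\<close>, so it is not invertible and lies in
      \<open>noninvertible\<close>, hence in \<open>J\<close>.\<close>
    then have "\<one> \<ominus> x \<otimes> y \<in> J"
      using not_acts_invertibly[of "\<one> \<ominus> x \<otimes> y"] x(2) J(2) by (auto simp: noninvertible_def)
    moreover have "x \<otimes> y \<in> J"
      using x(1) y(1) by (rule J.I_r_closed)
    ultimately have "(\<one> \<ominus> x \<otimes> y) \<oplus> x \<otimes> y \<in> J"
      by (rule J.a_closed)
    moreover have "(\<one> \<ominus> x \<otimes> y) \<oplus> x \<otimes> y = \<one>"
      using x(2)[THEN DiffD1] y(1) by algebra
    ultimately show False
      using n J.one_imp_carrier by simp
  qed
qed

sublocale at: module_at_prime R M noninvertible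
proof -
  interpret primeideal noninvertible R
    by (rule R.maximalideal_prime[OF maximalideal_noninvertible])
  show "module_at_prime R M noninvertible" ..
qed

lemma noninvertible_in_Supp: "noninvertible \<in> Supp R M"
proof -
  obtain m where m: "m \<in> carrier M" "m \<noteq> \<zero>\<^bsub>M\<^esub>"
    using nonzero M.zero_closed by blast
  have "w \<odot>\<^bsub>M\<^esub> m \<noteq> \<zero>\<^bsub>M\<^esub>" if w: "w \<in> carrier R - noninvertible" for w
    using complement_noninvertible[OF w] m by fastforce
  with m(1) show ?thesis
    unfolding at.mem_Supp_iff by blast
qed

text \<open>Membership in the support gives an \<open>m\<close> whose annihilator lies in
  \<open>Q\<close>. If some \<open>x\<close> in \<open>Q\<close> acted invertibly, then
  \<open>1 - x y\<close> would kill \<open>m\<close> and lie in \<open>Q\<close>, putting 1 there.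
  So \<open>Q\<close> is contained in \<open>noninvertible\<close>, and maximality gives
  equality.\<close>

lemma maximalideal_in_Supp_unique:
  assumes "Q \<in> Supp R M" "maximalideal Q R"
  shows "Q = noninvertible"
proof -
  interpret Q: maximalideal Q R by fact
  interpret Q: primeideal Q R by (rule R.maximalideal_prime[OF assms(2)])
  interpret Q: module_at_prime R M Q ..
  obtain m where m: "m \<in> carrier M" "\<And>w. w \<in> carrier R - Q \<Longrightarrow> w \<odot>\<^bsub>M\<^esub> m \<noteq> \<zero>\<^bsub>M\<^esub>"
    using assms(1) Q.mem_Supp_iff by blast
  have "Q \<subseteq> noninvertible"
  proof (rule ccontr)
    assume "\<not> ?thesis"
    then obtain x where x: "x \<in> Q" "x \<in> carrier R - noninvertible"
      using Q.Icarr by blast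
    obtain y where y: "y \<in> carrier R" "\<forall>m\<in>carrier M. (\<one> \<ominus> x \<otimes> y) \<odot>\<^bsub>M\<^esub> m = \<zero>\<^bsub>M\<^esub>"
      using one_minus_annihilates[OF x(2)] by blast
    have "\<one> \<ominus> x \<otimes> y \<in> Q"
      using m(2)[of "\<one> \<ominus> x \<otimes> y"] bspec[OF y(2) m(1)] x(2) y(1) by auto
    moreover have "x \<otimes> y \<in> Q"
      using x(1) y(1) by (rule Q.I_r_closed)
    ultimately have "(\<one> \<ominus> x \<otimes> y) \<oplus> x \<otimes> y \<in> Q"
      by (rule Q.a_closed)
    moreover have "(\<one> \<ominus> x \<otimes> y) \<oplus> x \<otimes> y = \<one>"
      using x(2)[THEN DiffD1] y(1) by algebra
    ultimately show False
      using Q.one_not_in_P by simp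
  qed
  moreover have "noninvertible \<subseteq> carrier R"
    unfolding noninvertible_def by blast
  ultimately have "noninvertible = Q \<or> noninvertible = carrier R"
    by (rule Q.I_maximal[OF ideal_noninvertible])
  with maximalideal.I_notcarr[OF maximalideal_noninvertible] show ?thesis
    by simp
qed

text \<open>Every denominator already acts bijectively on \<open>M\<close>, with its inverse given
  by an element \<open>y\<close> of \<open>R\<close>; the fraction x / s is the image of
  \<open>y x\<close>.\<close>

lemma localization_map_iso:
  "localization_map R M noninvertible \<in> module_iso R M (localization R M noninvertible)"
proof -
  let ?L = "localization R M noninvertible" and ?f = "localization_map R M noninvertible"
  note one = at.one_not_in_P
  have "?f \<in> hom (add_monoid M) (add_monoid ?L)"
    using one by (intro homI) (auto simp: localization_map_def at.add_frac at.frac_closed)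
  moreover have "inj_on ?f (carrier M)"
  proof (rule inj_onI)
    fix x y assume xy: "x \<in> carrier M" "y \<in> carrier M" "?f x = ?f y"
    then obtain w where "w \<in> carrier R - noninvertible" "w \<odot>\<^bsub>M\<^esub> x = w \<odot>\<^bsub>M\<^esub> y"
      using one by (auto simp: localization_map_def at.frac_eq_iff)
    then show "x = y"
      using complement_noninvertible xy(1,2) by metis
  qed
  moreover have "?f ` carrier M = carrier ?L"
  proof
    show "?f ` carrier M \<subseteq> carrier ?L"
      using one by (auto simp: localization_map_def at.frac_closed)
    show "carrier ?L \<subseteq> ?f ` carrier M"
    proof
      fix X assume "X \<in> carrier ?L"
      then obtain x s where x: "X = frac R M noninvertible x s" "x \<in> carrier M"
          "s \<in> carrier R - noninvertible"
        by (auto simp: at.carrier_localization)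
      obtain y where y: "y \<in> carrier R" "\<forall>m\<in>carrier M. s \<odot>\<^bsub>M\<^esub> (y \<odot>\<^bsub>M\<^esub> m) = m"
        using complement_noninvertible[OF x(3)] by auto
      have "X = ?f (y \<odot>\<^bsub>M\<^esub> x)"
        unfolding x(1) localization_map_def using x(2,3) y one by (intro at.frac_eqI) auto
      then show "X \<in> ?f ` carrier M"
        using x(2) y(1) by blast
    qed
  qed
  moreover have "?f (a \<odot>\<^bsub>M\<^esub> x) = a \<odot>\<^bsub>?L\<^esub> ?f x" if "a \<in> carrier R" "x \<in> carrier M" for a x
    using that one by (simp add: localization_map_def at.smult_frac)
  ultimately show ?thesis
    by (simp add: module_iso_def iso_def bij_betw_def)
qed

end

section \<open>Indecomposable modules over a clean ring\<close>

text \<open>The image of \<open>e\<close> in \<open>S\<close> is a central idempotent, so its action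
  is an \<open>S\<close>-linear projection of \<open>M\<close>. Then \<open>M\<close> is the direct
  sum of kernel and image, and indecomposability kills one of them.\<close>

lemma (in assoc_algebra) idempotent_acts_trivially:
  assumes "indecomposable_module S M" and e: "e \<in> carrier R" "e \<otimes> e = e"
  shows "(\<forall>m\<in>carrier M. (e \<odot>\<^bsub>S\<^esub> \<one>\<^bsub>S\<^esub>) \<odot>\<^bsub>M\<^esub> m = m) \<or>
    (\<forall>m\<in>carrier M. (e \<odot>\<^bsub>S\<^esub> \<one>\<^bsub>S\<^esub>) \<odot>\<^bsub>M\<^esub> m = \<zero>\<^bsub>M\<^esub>)"
proof -
  interpret L: left_module S M
    using assms(1) by (simp add: indecomposable_module_def)
  define f where "f m = (e \<odot>\<^bsub>S\<^esub> \<one>\<^bsub>S\<^esub>) \<odot>\<^bsub>M\<^esub> m" for m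
  have es: "e \<odot>\<^bsub>S\<^esub> \<one>\<^bsub>S\<^esub> \<in> carrier S" using e by simp
  have f_closed: "f m \<in> carrier M" if "m \<in> carrier M" for m
    using that es by (simp add: f_def L.left_smult_closed)
  have f_add: "f (m \<oplus>\<^bsub>M\<^esub> n) = f m \<oplus>\<^bsub>M\<^esub> f n" if "m \<in> carrier M" "n \<in> carrier M" for m n
    using that es by (simp add: f_def L.left_smult_r_distr)
  have f_f: "f (f m) = f m" if "m \<in> carrier M" for m
    using that es e by (simp add: f_def smult_mult_left flip: L.left_smult_assoc smult_assoc1)
  \<comment> \<open>Linearity over the possibly noncommutative \<open>S\<close> holds because
    scalars from \<open>R\<close> move past both factors of a product.\<close>
  have f_smult: "f (s \<odot>\<^bsub>M\<^esub> m) = s \<odot>\<^bsub>M\<^esub> f m" if "s \<in> carrier S" "m \<in> carrier M" for s m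
    using that es e by (simp add: f_def smult_mult_left smult_mult_right flip: L.left_smult_assoc)
  interpret f: abelian_group_hom M M f
    by (intro abelian_group_homI L.M.abelian_group_axioms group_hom.intro group_hom_axioms.intro
        L.M.a_group homI) (auto simp: f_closed f_add)
  have smult_zero: "s \<odot>\<^bsub>M\<^esub> \<zero>\<^bsub>M\<^esub> = \<zero>\<^bsub>M\<^esub>" if "s \<in> carrier S" for s
    using that L.left_smult_r_distr[of s "\<zero>\<^bsub>M\<^esub>" "\<zero>\<^bsub>M\<^esub>"] L.left_smult_closed[of s "\<zero>\<^bsub>M\<^esub>"] by simp
  \<comment> \<open>As \<open>f\<close> is idempotent, its image is the set \<open>?B\<close> of its
    fixed points.\<close>
  let ?A = "{m \<in> carrier M. f m = \<zero>\<^bsub>M\<^esub>}" and ?B = "{m \<in> carrier M. f m = m}"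
  have decomp: "m = (m \<ominus>\<^bsub>M\<^esub> f m) \<oplus>\<^bsub>M\<^esub> f m" "m \<ominus>\<^bsub>M\<^esub> f m \<in> ?A" "f m \<in> ?B"
    if "m \<in> carrier M" for m
    using that f_closed f_f by (simp_all add: L.M.minus_eq f_add L.M.a_assoc L.M.l_neg L.M.r_neg)
  have "submodule ?A S M"
  proof (intro submodule.intro submodule_axioms.intro L.M.add.subgroupI)
  qed (auto simp: f_add f_smult L.left_smult_closed smult_zero)
  moreover have "submodule ?B S M"
  proof (intro submodule.intro submodule_axioms.intro L.M.add.subgroupI)
  qed (auto simp: f_add f_smult L.left_smult_closed)
  moreover have "?A \<inter> ?B = {\<zero>\<^bsub>M\<^esub>}"
    by auto
  moreover have "?A <+>\<^bsub>M\<^esub> ?B = carrier M"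
  proof
    show "?A <+>\<^bsub>M\<^esub> ?B \<subseteq> carrier M"
      by (auto simp: set_add_def')
    show "carrier M \<subseteq> ?A <+>\<^bsub>M\<^esub> ?B"
    proof
      fix m assume m: "m \<in> carrier M"
      show "m \<in> ?A <+>\<^bsub>M\<^esub> ?B"
        using decomp[OF m] unfolding set_add_def' by blast
    qed
  qed
  ultimately have "?A = {\<zero>\<^bsub>M\<^esub>} \<or> ?B = {\<zero>\<^bsub>M\<^esub>}"
    using assms(1) unfolding indecomposable_module_def by blast
  then show ?thesis
  proof
    assume A: "?A = {\<zero>\<^bsub>M\<^esub>}"
    have "f m = m" if m: "m \<in> carrier M" for m
    proof -
      have "m \<ominus>\<^bsub>M\<^esub> f m = \<zero>\<^bsub>M\<^esub>"
        using decomp(2)[OF m] unfolding A by simp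
      then show ?thesis
        using decomp(1)[OF m] f_closed[OF m] by simp
    qed
    then show ?thesis by (simp add: f_def)
  next
    assume B: "?B = {\<zero>\<^bsub>M\<^esub>}"
    have "f m = \<zero>\<^bsub>M\<^esub>" if m: "m \<in> carrier M" for m
      using B f_closed[OF m] f_f[OF m] by blast
    then show ?thesis by (simp add: f_def)
  qed
qed

text \<open>Write \<open>x = u + e\<close>. If \<open>e\<close> acts as 0, then \<open>x\<close>
  acts as the unit \<open>u\<close>; if \<open>e\<close> acts as the identity, then
  \<open>1 - x\<close> acts as \<open>- u\<close>. In both cases the inverse comes from
  \<open>R\<close>.\<close>

lemma local_action_restrict_scalars:
  assumes clean: "clean_ring R" and S: "assoc_algebra R S" and M: "indecomposable_module S M"
  shows "local_action R (restrict_scalars S M)"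
proof -
  let ?N = "restrict_scalars S M"
  interpret S: assoc_algebra R S by fact
  interpret N: Module.module R ?N
    by (rule module_restrict_scalars[OF S]) (use M in \<open>simp add: indecomposable_module_def\<close>)
  have N: "carrier ?N = carrier M" "\<zero>\<^bsub>?N\<^esub> = \<zero>\<^bsub>M\<^esub>"
    "\<And>r m. r \<odot>\<^bsub>?N\<^esub> m = (r \<odot>\<^bsub>S\<^esub> \<one>\<^bsub>S\<^esub>) \<odot>\<^bsub>M\<^esub> m"
    by (simp_all add: restrict_scalars_def)
  show ?thesis
  proof (intro local_action.intro local_action_axioms.intro N.module_axioms)
    show "carrier ?N \<noteq> {\<zero>\<^bsub>?N\<^esub>}"
      using M by (simp add: N indecomposable_module_def)
    fix x assume "x \<in> carrier R"
    then obtain u e where u: "u \<in> Units R" and e: "e \<in> carrier R" "e \<otimes>\<^bsub>R\<^esub> e = e"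
      and x: "x = u \<oplus>\<^bsub>R\<^esub> e"
      using clean unfolding clean_ring_def by blast
    obtain v where v: "v \<in> carrier R" "u \<otimes>\<^bsub>R\<^esub> v = \<one>\<^bsub>R\<^esub>" and uR: "u \<in> carrier R"
      using u by (auto simp: Units_def)
    from S.idempotent_acts_trivially[OF M e]
    consider "\<And>m. m \<in> carrier ?N \<Longrightarrow> e \<odot>\<^bsub>?N\<^esub> m = m" | "\<And>m. m \<in> carrier ?N \<Longrightarrow> e \<odot>\<^bsub>?N\<^esub> m = \<zero>\<^bsub>?N\<^esub>"
      unfolding N by blast
    then show "N.acts_invertibly x \<or> N.acts_invertibly (\<one>\<^bsub>R\<^esub> \<ominus>\<^bsub>R\<^esub> x)"
    proof cases
      case 1
      have "((\<one>\<^bsub>R\<^esub> \<ominus>\<^bsub>R\<^esub> x) \<otimes>\<^bsub>R\<^esub> (\<ominus>\<^bsub>R\<^esub> v)) \<odot>\<^bsub>?N\<^esub> m = m" if m: "m \<in> carrier ?N" for m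
      proof -
        \<comment> \<open>The bracket on the right acts as 0 because \<open>e\<close> acts as the
          identity, and \<open>u v\<close> is 1.\<close>
        have "(\<one>\<^bsub>R\<^esub> \<ominus>\<^bsub>R\<^esub> x) \<otimes>\<^bsub>R\<^esub> (\<ominus>\<^bsub>R\<^esub> v) = u \<otimes>\<^bsub>R\<^esub> v \<oplus>\<^bsub>R\<^esub> (v \<otimes>\<^bsub>R\<^esub> e \<oplus>\<^bsub>R\<^esub> (\<ominus>\<^bsub>R\<^esub> v))"
          unfolding x using uR e(1) v(1) by algebra
        then show ?thesis
          using 1 v e(1) m
          by (simp add: N.smult_l_distr N.smult_assoc1 N.smult_l_minus N.M.r_neg)
      qed
      then show ?thesis
        unfolding N.acts_invertibly_def using v(1) by blast
    next
      case 2
      have "(x \<otimes>\<^bsub>R\<^esub> v) \<odot>\<^bsub>?N\<^esub> m = m" if m: "m \<in> carrier ?N" for m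
      proof -
        have "x \<otimes>\<^bsub>R\<^esub> v = u \<otimes>\<^bsub>R\<^esub> v \<oplus>\<^bsub>R\<^esub> v \<otimes>\<^bsub>R\<^esub> e"
          unfolding x using uR e(1) v(1) by algebra
        then show ?thesis
          using 2 v e(1) m by (simp add: N.smult_l_distr N.smult_assoc1)
      qed
      then show ?thesis
        unfolding N.acts_invertibly_def using v(1) by blast
    qed
  qed
qed

lemma clean_imp_unique_maximal:
  assumes "clean_ring R" "assoc_algebra R S" "indecomposable_module S M"
  shows "\<exists>!P. P \<in> Supp R (restrict_scalars S M) \<and> maximalideal P R"
proof -
  interpret local_action R "restrict_scalars S M"
    using assms by (rule local_action_restrict_scalars)
  show ?thesis
    using noninvertible_in_Supp maximalideal_noninvertible maximalideal_in_Supp_unique by blast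
qed

lemma clean_imp_localization_iso:
  assumes "clean_ring R" "assoc_algebra R S" "indecomposable_module S M"
    and P: "P \<in> Supp R (restrict_scalars S M)" "maximalideal P R"
  shows "localization_map R (restrict_scalars S M) P
    \<in> module_iso R (restrict_scalars S M) (localization R (restrict_scalars S M) P)"
proof -
  interpret local_action R "restrict_scalars S M"
    using assms(1-3) by (rule local_action_restrict_scalars)
  show ?thesis
    using localization_map_iso maximalideal_in_Supp_unique[OF P] by simp
qed

section \<open>The equivalence and the localization isomorphism\<close>

text \<open>Quantification over all algebras and modules has to be relative to carrier types. The
  two injections make \<open>'s\<close> and \<open>'m\<close> large enough to hold copies of
  \<open>R\<close> and of its quotients. The second conjunct has its own type variables
  \<open>'t\<close> and \<open>'n\<close>, so the consequences of cleanness hold on arbitrary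
  types.\<close>

theorem proposition3p2:
  fixes R :: "('a, 'r) ring_scheme"
  assumes "cring R"
  shows
    "((\<exists>i :: 'a \<Rightarrow> 's. inj_on i (carrier R)) \<and> (\<exists>j :: 'a \<Rightarrow> 'm. inj_on j (carrier R)) \<longrightarrow>
        ((\<forall>(S :: ('a, 's) module) (M :: ('s, 'm) module).
            assoc_algebra R S \<and> indecomposable_module S M \<longrightarrow>
            (\<exists>!P. P \<in> Supp R (restrict_scalars S M) \<and> maximalideal P R))
         \<longleftrightarrow> clean_ring R)) \<and>
     (clean_ring R \<longrightarrow>
        (\<forall>(S :: ('a, 't) module) (M :: ('t, 'n) module).
            assoc_algebra R S \<and> indecomposable_module S M \<longrightarrow>
            (\<exists>!P. P \<in> Supp R (restrict_scalars S M) \<and> maximalideal P R) \<and>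
            (\<forall>P. P \<in> Supp R (restrict_scalars S M) \<and> maximalideal P R \<longrightarrow>
               localization_map R (restrict_scalars S M) P
                 \<in> module_iso R (restrict_scalars S M)
                     (localization R (restrict_scalars S M) P))))"
proof -
  interpret cring R by fact
  show ?thesis
  proof (intro conjI impI iffI allI; (elim conjE exE)?)
    fix i :: "'a \<Rightarrow> 's" and j :: "'a \<Rightarrow> 'm"
    assume ij: "inj_on i (carrier R)" "inj_on j (carrier R)"
      and local: "\<forall>(S :: ('a, 's) module) (M :: ('s, 'm) module).
        assoc_algebra R S \<and> indecomposable_module S M \<longrightarrow>
        (\<exists>!P. P \<in> Supp R (restrict_scalars S M) \<and> maximalideal P R)"
    show "clean_ring R"
      by (rule clean_ring_if_indecomposable_local[OF ij local[rule_format, OF conjI]])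
  qed (rule clean_imp_unique_maximal clean_imp_localization_iso; assumption)+
qed

end
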